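(* Let $R$ be a commutative ring with unity $1\neq 0$ and let $E$ be a directed graph. The Leavitt path algebra $L_R(E)$ is dextral symmetric if and only if each connected component of $E$ is of one of the following two types: (i) a single vertex with no edges; (ii) a single vertex $v$ together with exactly one edge $e$, which is a loop at $v$ (that is, $s(e)=r(e)=v$).
   Context: A (not necessarily associative) algebra $A$ is dextral symmetric if for all $a,b,c\in A$, $a(bc)=0$ implies $b(ac)=0$. A graph is a directed graph $E=(E^0,E^1,r,s)$ with $E^0$ (vertices) and $E^1$ (edges) countable sets and maps $r,s:E^1\to E^0$ (range and source). Components are connected components of the underlying undirected graph. A vertex is regular if it emits a nonempty finite set of edges. For each edge $e$ there is a ghost edge $e^*$ with $s(e^* )=r(e)$ and $r(e^* )=s(e)$. The Leavitt path algebra $L_R(E)$ is the (associative, not necessarily unital) $R$-algebra generated by a set of pairwise orthogonal idempotents $\{v : v\in E^0\}$ together with $\{e,e^* : e\in E^1\}$, subject to: (1) $s(e)e=e=e\,r(e)$ for all $e\in E^1$; (2) $r(e)e^*=e^*=e^*s(e)$ for all $e\in E^1$; (3) $e^*e=r(e)$ and $e^*f=0$ for all $e,f\in E^1$ with $e\ne f$; (4) $v=\sum_{e\in E^1,\ s(e)=v} ee^*$ for every regular vertex $v\in E^0$. *)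

theory Defs
  imports "HOL-Library.Countable_Set" "Graph_Theory.Digraph_Component"
begin

section \<open>Algebras that need not be associative or unital\<close>

record ('r, 'a) nonassoc_algebra =
  alg_carrier :: "'a set"
  alg_add :: "'a \<Rightarrow> 'a \<Rightarrow> 'a"
  alg_zero :: "'a"
  alg_smult :: "'r \<Rightarrow> 'a \<Rightarrow> 'a"
  alg_mult :: "'a \<Rightarrow> 'a \<Rightarrow> 'a"

locale nonassoc_algebra =
  fixes A :: "('r::comm_ring_1, 'a) nonassoc_algebra"
  assumes zero_closed: "alg_zero A \<in> alg_carrier A"
    and add_closed: "\<lbrakk>x \<in> alg_carrier A; y \<in> alg_carrier A\<rbrakk> \<Longrightarrow> alg_add A x y \<in> alg_carrier A"
    and smult_closed: "x \<in> alg_carrier A \<Longrightarrow> alg_smult A r x \<in> alg_carrier A"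
    and mult_closed: "\<lbrakk>x \<in> alg_carrier A; y \<in> alg_carrier A\<rbrakk> \<Longrightarrow> alg_mult A x y \<in> alg_carrier A"
    and add_assoc: "\<lbrakk>x \<in> alg_carrier A; y \<in> alg_carrier A; z \<in> alg_carrier A\<rbrakk>
      \<Longrightarrow> alg_add A (alg_add A x y) z = alg_add A x (alg_add A y z)"
    and add_commute: "\<lbrakk>x \<in> alg_carrier A; y \<in> alg_carrier A\<rbrakk>
      \<Longrightarrow> alg_add A x y = alg_add A y x"
    and add_zero: "x \<in> alg_carrier A \<Longrightarrow> alg_add A x (alg_zero A) = x"
    and add_inverse: "x \<in> alg_carrier A
      \<Longrightarrow> \<exists>y \<in> alg_carrier A. alg_add A x y = alg_zero A"
    and smult_one: "x \<in> alg_carrier A \<Longrightarrow> alg_smult A 1 x = x"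
    and smult_smult: "x \<in> alg_carrier A
      \<Longrightarrow> alg_smult A r (alg_smult A s x) = alg_smult A (r * s) x"
    and smult_add_left: "x \<in> alg_carrier A
      \<Longrightarrow> alg_smult A (r + s) x = alg_add A (alg_smult A r x) (alg_smult A s x)"
    and smult_add_right: "\<lbrakk>x \<in> alg_carrier A; y \<in> alg_carrier A\<rbrakk>
      \<Longrightarrow> alg_smult A r (alg_add A x y) = alg_add A (alg_smult A r x) (alg_smult A r y)"
    and mult_add_left: "\<lbrakk>x \<in> alg_carrier A; y \<in> alg_carrier A; z \<in> alg_carrier A\<rbrakk>
      \<Longrightarrow> alg_mult A (alg_add A x y) z = alg_add A (alg_mult A x z) (alg_mult A y z)"
    and mult_add_right: "\<lbrakk>x \<in> alg_carrier A; y \<in> alg_carrier A; z \<in> alg_carrier A\<rbrakk>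
      \<Longrightarrow> alg_mult A x (alg_add A y z) = alg_add A (alg_mult A x y) (alg_mult A x z)"
    and mult_smult_left: "\<lbrakk>x \<in> alg_carrier A; y \<in> alg_carrier A\<rbrakk>
      \<Longrightarrow> alg_mult A (alg_smult A r x) y = alg_smult A r (alg_mult A x y)"
    and mult_smult_right: "\<lbrakk>x \<in> alg_carrier A; y \<in> alg_carrier A\<rbrakk>
      \<Longrightarrow> alg_mult A x (alg_smult A r y) = alg_smult A r (alg_mult A x y)"

locale assoc_algebra = nonassoc_algebra +
  assumes mult_assoc: "\<lbrakk>x \<in> alg_carrier A; y \<in> alg_carrier A; z \<in> alg_carrier A\<rbrakk>
      \<Longrightarrow> alg_mult A (alg_mult A x y) z = alg_mult A x (alg_mult A y z)"

definition dextral_symmetric :: "('r, 'a) nonassoc_algebra \<Rightarrow> bool" where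
  "dextral_symmetric A \<longleftrightarrow>
    (\<forall>a \<in> alg_carrier A. \<forall>b \<in> alg_carrier A. \<forall>c \<in> alg_carrier A.
      alg_mult A a (alg_mult A b c) = alg_zero A \<longrightarrow>
      alg_mult A b (alg_mult A a c) = alg_zero A)"


section \<open>Leavitt path algebras\<close>

text \<open>
  A directed graph is a \<^typ>\<open>('v, 'e) pre_digraph\<close> satisfying \<^const>\<open>wf_digraph\<close>; loops and
  parallel edges are allowed. The source map is \<^const>\<open>tail\<close> and the range map is \<^const>\<open>head\<close>.
  Its connected components are its maximal subgraphs whose underlying undirected graph is connected;
  a subgraph inherits the maps \<^const>\<open>tail\<close> and \<^const>\<open>head\<close>.
\<close>

definition regular_vertex :: "('v, 'e) pre_digraph \<Rightarrow> 'v \<Rightarrow> bool" where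
  "regular_vertex E v \<longleftrightarrow> v \<in> verts E \<and> finite (out_arcs E v) \<and> out_arcs E v \<noteq> {}"

text \<open>
  The algebra is given by generators and relations: its elements are the algebra expressions in
  the generators, taken modulo the least congruence that contains the laws of an associative
  algebra over \<^typ>\<open>'r\<close> and the defining relations. The expression \<open>Ghost e\<close> stands for
  the ghost edge of \<open>e\<close>.
\<close>

datatype ('r, 'v, 'e) lpa_term =
    Zero
  | Vertex 'v
  | Edge 'e
  | Ghost 'e
  | Add "('r, 'v, 'e) lpa_term" "('r, 'v, 'e) lpa_term"
  | Scale 'r "('r, 'v, 'e) lpa_term"
  | Mult "('r, 'v, 'e) lpa_term" "('r, 'v, 'e) lpa_term"

inductive_set lpa_terms :: "('v, 'e) pre_digraph \<Rightarrow> ('r, 'v, 'e) lpa_term set"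
  for E :: "('v, 'e) pre_digraph" where
  Zero: "Zero \<in> lpa_terms E"
| Vertex: "v \<in> verts E \<Longrightarrow> Vertex v \<in> lpa_terms E"
| Edge: "e \<in> arcs E \<Longrightarrow> Edge e \<in> lpa_terms E"
| Ghost: "e \<in> arcs E \<Longrightarrow> Ghost e \<in> lpa_terms E"
| Add: "\<lbrakk>a \<in> lpa_terms E; b \<in> lpa_terms E\<rbrakk> \<Longrightarrow> Add a b \<in> lpa_terms E"
| Scale: "a \<in> lpa_terms E \<Longrightarrow> Scale r a \<in> lpa_terms E"
| Mult: "\<lbrakk>a \<in> lpa_terms E; b \<in> lpa_terms E\<rbrakk> \<Longrightarrow> Mult a b \<in> lpa_terms E"

text \<open>
  Additive inverses are given by \<open>Scale (- 1) a\<close>, in view of the rules \<open>scale_add_left\<close>,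
  \<open>scale_one\<close> and \<open>scale_zero\<close>. In the rule \<open>regular\<close>, the finite sum over the edges emitted by
  \<open>v\<close> is written out along an enumeration \<open>es\<close> of these edges without repetition.
\<close>

inductive_set lpa_rel ::
    "('v, 'e) pre_digraph \<Rightarrow>
      (('r::comm_ring_1, 'v, 'e) lpa_term \<times> ('r, 'v, 'e) lpa_term) set"
  for E :: "('v, 'e) pre_digraph" where
  refl: "a \<in> lpa_terms E \<Longrightarrow> (a, a) \<in> lpa_rel E"
| sym: "(a, b) \<in> lpa_rel E \<Longrightarrow> (b, a) \<in> lpa_rel E"
| trans: "\<lbrakk>(a, b) \<in> lpa_rel E; (b, c) \<in> lpa_rel E\<rbrakk> \<Longrightarrow> (a, c) \<in> lpa_rel E"
| add_cong: "\<lbrakk>(a, a') \<in> lpa_rel E; (b, b') \<in> lpa_rel E\<rbrakk>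
    \<Longrightarrow> (Add a b, Add a' b') \<in> lpa_rel E"
| scale_cong: "(a, a') \<in> lpa_rel E \<Longrightarrow> (Scale r a, Scale r a') \<in> lpa_rel E"
| mult_cong: "\<lbrakk>(a, a') \<in> lpa_rel E; (b, b') \<in> lpa_rel E\<rbrakk>
    \<Longrightarrow> (Mult a b, Mult a' b') \<in> lpa_rel E"

| add_assoc: "\<lbrakk>a \<in> lpa_terms E; b \<in> lpa_terms E; c \<in> lpa_terms E\<rbrakk>
    \<Longrightarrow> (Add (Add a b) c, Add a (Add b c)) \<in> lpa_rel E"
| add_commute: "\<lbrakk>a \<in> lpa_terms E; b \<in> lpa_terms E\<rbrakk> \<Longrightarrow> (Add a b, Add b a) \<in> lpa_rel E"
| add_zero: "a \<in> lpa_terms E \<Longrightarrow> (Add a Zero, a) \<in> lpa_rel E"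
| scale_zero: "a \<in> lpa_terms E \<Longrightarrow> (Scale 0 a, Zero) \<in> lpa_rel E"
| scale_one: "a \<in> lpa_terms E \<Longrightarrow> (Scale 1 a, a) \<in> lpa_rel E"
| scale_scale: "a \<in> lpa_terms E \<Longrightarrow> (Scale r (Scale s a), Scale (r * s) a) \<in> lpa_rel E"
| scale_add_left: "a \<in> lpa_terms E
    \<Longrightarrow> (Scale (r + s) a, Add (Scale r a) (Scale s a)) \<in> lpa_rel E"
| scale_add_right: "\<lbrakk>a \<in> lpa_terms E; b \<in> lpa_terms E\<rbrakk>
    \<Longrightarrow> (Scale r (Add a b), Add (Scale r a) (Scale r b)) \<in> lpa_rel E"
| mult_assoc: "\<lbrakk>a \<in> lpa_terms E; b \<in> lpa_terms E; c \<in> lpa_terms E\<rbrakk>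
    \<Longrightarrow> (Mult (Mult a b) c, Mult a (Mult b c)) \<in> lpa_rel E"
| mult_add_left: "\<lbrakk>a \<in> lpa_terms E; b \<in> lpa_terms E; c \<in> lpa_terms E\<rbrakk>
    \<Longrightarrow> (Mult (Add a b) c, Add (Mult a c) (Mult b c)) \<in> lpa_rel E"
| mult_add_right: "\<lbrakk>a \<in> lpa_terms E; b \<in> lpa_terms E; c \<in> lpa_terms E\<rbrakk>
    \<Longrightarrow> (Mult a (Add b c), Add (Mult a b) (Mult a c)) \<in> lpa_rel E"
| mult_scale_left: "\<lbrakk>a \<in> lpa_terms E; b \<in> lpa_terms E\<rbrakk>
    \<Longrightarrow> (Mult (Scale r a) b, Scale r (Mult a b)) \<in> lpa_rel E"
| mult_scale_right: "\<lbrakk>a \<in> lpa_terms E; b \<in> lpa_terms E\<rbrakk>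
    \<Longrightarrow> (Mult a (Scale r b), Scale r (Mult a b)) \<in> lpa_rel E"

| vertex_idem: "v \<in> verts E \<Longrightarrow> (Mult (Vertex v) (Vertex v), Vertex v) \<in> lpa_rel E"
| vertex_orth: "\<lbrakk>v \<in> verts E; w \<in> verts E; v \<noteq> w\<rbrakk>
    \<Longrightarrow> (Mult (Vertex v) (Vertex w), Zero) \<in> lpa_rel E"
| source_edge: "e \<in> arcs E \<Longrightarrow> (Mult (Vertex (tail E e)) (Edge e), Edge e) \<in> lpa_rel E"
| edge_range: "e \<in> arcs E \<Longrightarrow> (Mult (Edge e) (Vertex (head E e)), Edge e) \<in> lpa_rel E"
| range_ghost: "e \<in> arcs E \<Longrightarrow> (Mult (Vertex (head E e)) (Ghost e), Ghost e) \<in> lpa_rel E"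
| ghost_source: "e \<in> arcs E \<Longrightarrow> (Mult (Ghost e) (Vertex (tail E e)), Ghost e) \<in> lpa_rel E"
| ghost_edge: "e \<in> arcs E \<Longrightarrow> (Mult (Ghost e) (Edge e), Vertex (head E e)) \<in> lpa_rel E"
| ghost_edge_orth: "\<lbrakk>e \<in> arcs E; f \<in> arcs E; e \<noteq> f\<rbrakk>
    \<Longrightarrow> (Mult (Ghost e) (Edge f), Zero) \<in> lpa_rel E"
| regular: "\<lbrakk>regular_vertex E v; distinct es; set es = out_arcs E v\<rbrakk>
    \<Longrightarrow> (Vertex v, foldr (\<lambda>e. Add (Mult (Edge e) (Ghost e))) es Zero) \<in> lpa_rel E"

type_synonym ('r, 'v, 'e) lpa = "('r, ('r, 'v, 'e) lpa_term set) nonassoc_algebra"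

definition leavitt_path_algebra ::
    "('v, 'e) pre_digraph \<Rightarrow> ('r::comm_ring_1, 'v, 'e) lpa" where
  "leavitt_path_algebra E = \<lparr>
     alg_carrier = lpa_terms E // lpa_rel E,
     alg_add = (\<lambda>X Y. \<Union>a \<in> X. \<Union>b \<in> Y. lpa_rel E `` {Add a b}),
     alg_zero = lpa_rel E `` {Zero},
     alg_smult = (\<lambda>r X. \<Union>a \<in> X. lpa_rel E `` {Scale r a}),
     alg_mult = (\<lambda>X Y. \<Union>a \<in> X. \<Union>b \<in> Y. lpa_rel E `` {Mult a b})\<rparr>"

lemma sum_term_in_lpa_terms:
  "set es \<subseteq> arcs E \<Longrightarrow> foldr (\<lambda>e. Add (Mult (Edge e) (Ghost e))) es Zero \<in> lpa_terms E"
  by (induction es) (auto intro: lpa_terms.intros)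

lemma lpa_rel_in_lpa_terms:
  assumes "wf_digraph E" and "(a, b) \<in> lpa_rel E"
  shows "a \<in> lpa_terms E \<and> b \<in> lpa_terms E"
proof -
  interpret wf_digraph E by fact
  from assms(2) show ?thesis
    by (induction rule: lpa_rel.induct)
      (auto intro!: lpa_terms.intros sum_term_in_lpa_terms
        simp: regular_vertex_def out_arcs_def)
qed

lemma equiv_lpa_rel:
  assumes "wf_digraph E"
  shows "equiv (lpa_terms E) (lpa_rel E)"
  using lpa_rel_in_lpa_terms[OF assms]
  by (intro equivI refl_onI symI transI) (auto intro: lpa_rel.intros(1-3))

text \<open>The operations act on the class \<open>lpa_rel E `` {a}\<close> through the representative \<open>a\<close>.\<close>

lemma alg_carrier_lpa:
  "alg_carrier (leavitt_path_algebra E) = (\<lambda>a. lpa_rel E `` {a}) ` lpa_terms E"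
  by (auto simp: leavitt_path_algebra_def quotient_def)

lemma alg_zero_lpa: "alg_zero (leavitt_path_algebra E) = lpa_rel E `` {Zero}"
  by (simp add: leavitt_path_algebra_def)

lemma alg_add_lpa:
  assumes "wf_digraph E" "a \<in> lpa_terms E" "b \<in> lpa_terms E"
  shows "alg_add (leavitt_path_algebra E) (lpa_rel E `` {a}) (lpa_rel E `` {b}) =
    lpa_rel E `` {Add a b}"
proof -
  note eq = equiv_lpa_rel[OF assms(1)]
  have "(\<lambda>a b. lpa_rel E `` {Add a b}) respects2 lpa_rel E"
    by (rule congruent2I') (auto intro!: equiv_class_eq[OF eq] lpa_rel.add_cong)
  from UN_equiv_class2[OF eq eq this assms(2,3)] show ?thesis
    by (simp add: leavitt_path_algebra_def)
qed

lemma alg_mult_lpa: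
  assumes "wf_digraph E" "a \<in> lpa_terms E" "b \<in> lpa_terms E"
  shows "alg_mult (leavitt_path_algebra E) (lpa_rel E `` {a}) (lpa_rel E `` {b}) =
    lpa_rel E `` {Mult a b}"
proof -
  note eq = equiv_lpa_rel[OF assms(1)]
  have "(\<lambda>a b. lpa_rel E `` {Mult a b}) respects2 lpa_rel E"
    by (rule congruent2I') (auto intro!: equiv_class_eq[OF eq] lpa_rel.mult_cong)
  from UN_equiv_class2[OF eq eq this assms(2,3)] show ?thesis
    by (simp add: leavitt_path_algebra_def)
qed

lemma alg_smult_lpa:
  assumes "wf_digraph E" "a \<in> lpa_terms E"
  shows "alg_smult (leavitt_path_algebra E) r (lpa_rel E `` {a}) = lpa_rel E `` {Scale r a}"
proof -
  note eq = equiv_lpa_rel[OF assms(1)]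
  have "(\<lambda>a. lpa_rel E `` {Scale r a}) respects lpa_rel E"
    by (rule congruentI) (auto intro!: equiv_class_eq[OF eq] lpa_rel.scale_cong)
  from UN_equiv_class[OF eq this assms(2)] show ?thesis
    by (simp add: leavitt_path_algebra_def)
qed

theorem assoc_algebra_lpa:
  assumes wf: "wf_digraph E"
  shows "assoc_algebra (leavitt_path_algebra E :: ('r::comm_ring_1, 'v, 'e) lpa)"
proof -
  let ?L = "leavitt_path_algebra E :: ('r, 'v, 'e) lpa"
  have inverse: "\<exists>y \<in> alg_carrier ?L. alg_add ?L x y = alg_zero ?L"
    if "x \<in> alg_carrier ?L" for x
  proof -
    from that obtain a :: "('r, 'v, 'e) lpa_term"
      where a: "a \<in> lpa_terms E" "x = lpa_rel E `` {a}"
      by (auto simp: alg_carrier_lpa)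
    have "(Add a (Scale (- 1) a), Add (Scale 1 a) (Scale (- 1) a)) \<in> lpa_rel E"
      using a by (intro lpa_rel.add_cong lpa_rel.sym[OF lpa_rel.scale_one])
        (auto intro: lpa_rel.refl lpa_terms.intros)
    moreover have "(Add (Scale 1 a) (Scale (- 1) a), Scale (1 + - 1) a) \<in> lpa_rel E"
      using a by (intro lpa_rel.sym[OF lpa_rel.scale_add_left])
    moreover have "(Scale (1 + - 1) a, Zero) \<in> lpa_rel E"
      using lpa_rel.scale_zero[OF a(1)] by simp
    ultimately have "(Add a (Scale (- 1) a), Zero) \<in> lpa_rel E"
      by (blast intro: lpa_rel.trans)
    then show ?thesis
      using a equiv_class_eq[OF equiv_lpa_rel[OF wf]]
      by (intro bexI[of _ "lpa_rel E `` {Scale (- 1) a}"])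
        (auto simp: alg_add_lpa[OF wf] alg_carrier_lpa alg_zero_lpa lpa_terms.Scale)
  qed
  show ?thesis
    by (unfold_locales;
      ((rule inverse, assumption) |
        auto simp: alg_carrier_lpa alg_zero_lpa alg_add_lpa[OF wf] alg_mult_lpa[OF wf]
          alg_smult_lpa[OF wf] lpa_terms.intros
          intro!: equiv_class_eq[OF equiv_lpa_rel[OF wf]] lpa_rel.intros(7-19)
          simp del: Image_singleton_iff del: equalityI subsetI))
qed

end

theory Submission
  imports Defs
begin

text \<open>
  If \<open>e\<close> is an edge from \<open>v\<close> to \<open>w \<noteq> v\<close>, then \<open>e (v w) = 0\<close> but \<open>v (e w) = e\<close>; if \<open>e \<noteq> f\<close> are loops
  at the same vertex, then \<open>e (e\<^sup>* f) = 0\<close> but \<open>e\<^sup>* (e f) = f\<close>. Since edges are nonzero, dextral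
  symmetry thus leaves only isolated vertices and isolated loops, and for those the algebra is
  commutative. Vertices, and hence edges, are seen to be nonzero in a representation of the
  algebra by operators on functions.
\<close>

section \<open>Connected components\<close>

text \<open>The set \<open>S\<close> consists of the vertices reachable from \<open>v\<close> when
  edges may be traversed in either direction. The last clause serves to place every edge emitted by
  \<open>v\<close> inside the component.\<close>

lemma (in wf_digraph) ex_connected_component:
  assumes v: "v \<in> verts G"
  shows "\<exists>S. v \<in> S \<and> max_subgraph Digraph_Component.connected (G \<restriction> S) \<and>
    (\<forall>e \<in> arcs G. tail G e \<in> S \<longleftrightarrow> head G e \<in> S)"
proof -
  define S where "S = {w. (v, w) \<in> rtrancl_on (verts G) ((arcs_ends G)\<^sup>s)}"
  have vS: "v \<in> S" using v by (simp add: S_def)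
  have S_sub: "S \<subseteq> verts G" by (auto simp: S_def dest: in_rtrancl_on_in_F)
  have S_arc: "tail G e \<in> S \<longleftrightarrow> head G e \<in> S" if "e \<in> arcs G" for e
  proof -
    have "(tail G e, head G e) \<in> (arcs_ends G)\<^sup>s" "(head G e, tail G e) \<in> (arcs_ends G)\<^sup>s"
      using that by (auto simp: arcs_ends_conv symcl_def)
    then show ?thesis using that
      by (auto simp: S_def intro: rtrancl_on_into_rtrancl_on)
  qed
  \<comment> \<open>Every vertex on an undirected path from \<open>v\<close> is itself reachable
    from \<open>v\<close>, so the path never leaves \<open>S\<close> and survives in the induced
    subgraph.\<close>
  have conn_v: "(v, w) \<in> rtrancl_on S ((arcs_ends (G \<restriction> S))\<^sup>s)" if "w \<in> S" for w
  proof -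
    from that have "(v, w) \<in> rtrancl_on (verts G) ((arcs_ends G)\<^sup>s)" by (simp add: S_def)
    then show ?thesis
    proof (induction rule: rtrancl_on_induct)
      case base
      then show ?case using vS by simp
    next
      case (step x y)
      have x: "x \<in> S" using step.hyps by (simp add: S_def)
      have y: "y \<in> S" using step.hyps by (auto simp: S_def intro: rtrancl_on_into_rtrancl_on)
      from step.hyps x y have "(x, y) \<in> (arcs_ends (G \<restriction> S))\<^sup>s"
        by (auto simp: arcs_ends_conv symcl_def)
      with step.IH y show ?case by (blast intro: rtrancl_on_into_rtrancl_on)
    qed
  qed
  have sym: "(w, v) \<in> rtrancl_on S ((arcs_ends (G \<restriction> S))\<^sup>s)" if "w \<in> S" for w
    by (rule symD[OF rtrancl_on_sym conn_v[OF that]]) (auto simp: sym_def symcl_def)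
  have conn: "Digraph_Component.connected (G \<restriction> S)"
    unfolding connected_conv using vS rtrancl_on_trans[OF sym conn_v] by auto
  \<comment> \<open>Maximality: a connected \<open>H\<close> above the induced subgraph contains
    \<open>v\<close>, so all its vertices are reachable from \<open>v\<close> already in
    \<open>G\<close> and lie in \<open>S\<close>. An induced subgraph has no room for further edges
    on the same vertices.\<close>
  have "H = G \<restriction> S"
    if "subgraph (G \<restriction> S) H" "subgraph H G" "Digraph_Component.connected H" for H
  proof -
    have "w \<in> S" if "w \<in> verts H" for w
    proof -
      have "(v, w) \<in> rtrancl_on (verts H) ((arcs_ends H)\<^sup>s)"
        using vS that \<open>Digraph_Component.connected H\<close> subgraph_imp_subverts[OF \<open>subgraph (G \<restriction> S) H\<close>]
        unfolding connected_conv by auto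
      moreover have "(arcs_ends H)\<^sup>s \<subseteq> (arcs_ends G)\<^sup>s"
        using arcs_ends_mono[OF \<open>subgraph H G\<close>] by (auto simp: symcl_def)
      moreover have "verts H \<subseteq> verts G" using \<open>subgraph H G\<close> by auto
      ultimately have "(v, w) \<in> rtrancl_on (verts G) ((arcs_ends G)\<^sup>s)"
        by (rule rtrancl_on_mono[rotated 2])
      then show ?thesis by (simp add: S_def)
    qed
    then have verts: "verts H = S"
      using subgraph_imp_subverts[OF \<open>subgraph (G \<restriction> S) H\<close>] by auto
    moreover have "tail H = tail G" "head H = head G"
      using \<open>subgraph H G\<close> by (auto simp: compatible_def)
    moreover have "arcs H = arcs (G \<restriction> S)"
    proof
      show "arcs (G \<restriction> S) \<subseteq> arcs H"
        using \<open>subgraph (G \<restriction> S) H\<close> by (simp add: subgraph_def)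
      interpret H: wf_digraph H using \<open>subgraph H G\<close> by auto
      show "arcs H \<subseteq> arcs (G \<restriction> S)"
        using \<open>subgraph H G\<close> H.tail_in_verts H.head_in_verts verts
          \<open>tail H = tail G\<close> \<open>head H = head G\<close> by auto
    qed
    ultimately show ?thesis by (intro pre_digraph.equality) auto
  qed
  with conn have "max_subgraph Digraph_Component.connected (G \<restriction> S)"
    using induced_imp_subgraph[OF induced_induce[OF S_sub]] by (auto simp: max_subgraph_def)
  with vS S_arc show ?thesis by blast
qed

text \<open>A walk along loops never leaves its starting vertex, and connectedness includes having a
  vertex.\<close>

lemma connected_only_loops:
  assumes "Digraph_Component.connected G" and loops: "\<forall>e \<in> arcs G. head G e = tail G e"
  shows "\<exists>v. verts G = {v}"
proof -
  have "u = w" if "(u, w) \<in> rtrancl_on (verts G) ((arcs_ends G)\<^sup>s)" for u w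
    using that
    by induction (use loops in \<open>auto simp: arcs_ends_conv symcl_def\<close>)
  with assms(1) show ?thesis unfolding connected_conv by blast
qed

text \<open>This trades components for a local condition that can be tested by products of
  generators: all edges are loops, and no two share a source.\<close>

lemma components_iff:
  fixes E :: "('v, 'e) pre_digraph"
  assumes "wf_digraph E"
  shows "(\<forall>C. pre_digraph.max_subgraph E Digraph_Component.connected C \<longrightarrow>
      (\<exists>v. verts C = {v} \<and> arcs C = {}) \<or>
      (\<exists>v e. verts C = {v} \<and> arcs C = {e} \<and> tail C e = v \<and> head C e = v)) \<longleftrightarrow>
    (\<forall>e \<in> arcs E. head E e = tail E e) \<and> inj_on (tail E) (arcs E)"
    (is "?comp \<longleftrightarrow> ?loops \<and> ?inj")
proof
  interpret wf_digraph E by fact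
  assume comp: ?comp
  \<comment> \<open>Edges with a common source lie in one component, which has at most one edge, and
    that edge is a loop. The case \<open>f = e\<close> gives the loop condition, the general case
    injectivity.\<close>
  have *: "head E e = tail E e \<and> f = e"
    if ef: "e \<in> arcs E" "f \<in> arcs E" "tail E f = tail E e" for e f
  proof -
    obtain S where S: "tail E e \<in> S" "max_subgraph Digraph_Component.connected (E \<restriction> S)"
      "\<forall>e \<in> arcs E. tail E e \<in> S \<longleftrightarrow> head E e \<in> S"
      using ex_connected_component[OF tail_in_verts[OF ef(1)]] by (elim exE conjE)
    with ef have "e \<in> arcs (E \<restriction> S)" "f \<in> arcs (E \<restriction> S)" by fastforce+
    moreover from comp S(2) have "arcs (E \<restriction> S) = {} \<or>
        (\<exists>v e. arcs (E \<restriction> S) = {e} \<and> tail (E \<restriction> S) e = v \<and> head (E \<restriction> S) e = v)"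
      by blast
    ultimately show ?thesis by (metis empty_iff induce_subgraph_head induce_subgraph_tail singletonD)
  qed
  then show "?loops \<and> ?inj" by (auto simp: inj_on_def)
next
  interpret wf_digraph E by fact
  assume E: "?loops \<and> ?inj"
  show ?comp
  proof (intro allI impI)
    fix C assume "max_subgraph Digraph_Component.connected C"
    then have C: "subgraph C E" "Digraph_Component.connected C" by (auto simp: max_subgraph_def)
    then interpret C: wf_digraph C by auto
    have ends: "tail C = tail E" "head C = head E" and arcs: "arcs C \<subseteq> arcs E"
      using C by (auto simp: compatible_def)
    obtain v where v: "verts C = {v}" using connected_only_loops[OF C(2)] E ends arcs by auto
    have "tail C e = v \<and> head C e = v" if "e \<in> arcs C" for e
      using that C.tail_in_verts C.head_in_verts v by blast
    moreover from this have "e = f" if "e \<in> arcs C" "f \<in> arcs C" for e f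
      using that E ends arcs by (metis inj_onD subsetD)
    ultimately show "(\<exists>v. verts C = {v} \<and> arcs C = {}) \<or>
      (\<exists>v e. verts C = {v} \<and> arcs C = {e} \<and> tail C e = v \<and> head C e = v)"
      using v by blast
  qed
qed


section \<open>Computing in Leavitt path algebras\<close>

text \<open>From here on, computations take place with terms modulo the congruence instead of with
  classes.\<close>

lemma dextral_symmetric_lpa_iff:
  fixes E :: "('v, 'e) pre_digraph"
  assumes "wf_digraph E"
  shows "dextral_symmetric (leavitt_path_algebra E :: ('r::comm_ring_1, 'v, 'e) lpa) \<longleftrightarrow>
    (\<forall>a \<in> lpa_terms E. \<forall>b \<in> lpa_terms E. \<forall>c \<in> lpa_terms E.
      (Mult a (Mult b c) :: ('r, 'v, 'e) lpa_term, Zero) \<in> lpa_rel E \<longrightarrow>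
      (Mult b (Mult a c), Zero) \<in> lpa_rel E)"
  by (simp add: dextral_symmetric_def alg_carrier_lpa alg_zero_lpa alg_mult_lpa[OF assms]
      eq_equiv_class_iff[OF equiv_lpa_rel[OF assms]] lpa_terms.intros)

section \<open>Vanishing products\<close>

declare lpa_rel.trans [trans]

text \<open>The defining relations have no rule for products with \<open>Zero\<close>, so
  \<open>Zero\<close> is rewritten as the scalar 0 times itself and the scalar is moved out of the
  product.\<close>

lemma mult_zero_right:
  assumes "a \<in> lpa_terms E"
  shows "(Mult a Zero, Zero) \<in> lpa_rel E"
proof -
  have "(Mult a Zero, Mult a (Scale 0 Zero)) \<in> lpa_rel E"
    using assms by (intro lpa_rel.mult_cong lpa_rel.refl lpa_rel.sym[OF lpa_rel.scale_zero] lpa_terms.Zero)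
  also have "(Mult a (Scale 0 Zero), Scale 0 (Mult a Zero)) \<in> lpa_rel E"
    using assms by (intro lpa_rel.mult_scale_right lpa_terms.Zero)
  also have "(Scale 0 (Mult a Zero), Zero) \<in> lpa_rel E"
    using assms by (intro lpa_rel.scale_zero lpa_terms.intros)
  finally show ?thesis .
qed

lemma mult_zero_left:
  assumes "a \<in> lpa_terms E"
  shows "(Mult Zero a, Zero) \<in> lpa_rel E"
proof -
  have "(Mult Zero a, Mult (Scale 0 Zero) a) \<in> lpa_rel E"
    using assms by (intro lpa_rel.mult_cong lpa_rel.refl lpa_rel.sym[OF lpa_rel.scale_zero] lpa_terms.Zero)
  also have "(Mult (Scale 0 Zero) a, Scale 0 (Mult Zero a)) \<in> lpa_rel E"
    using assms by (intro lpa_rel.mult_scale_left lpa_terms.Zero)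
  also have "(Scale 0 (Mult Zero a), Zero) \<in> lpa_rel E"
    using assms by (intro lpa_rel.scale_zero lpa_terms.intros)
  finally show ?thesis .
qed

text \<open>Since \<open>x\<close> is a right unit for \<open>a\<close> and \<open>y\<close> a left
  unit for \<open>b\<close>, the product \<open>ab\<close> equals \<open>a(xy)b\<close>. The
  intended \<open>x\<close> and \<open>y\<close> are orthogonal vertices.\<close>

lemma mult_eq_zero:
  assumes ax: "(Mult a x, a) \<in> lpa_rel E" and yb: "(Mult y b, b) \<in> lpa_rel E"
    and xy: "(Mult x y, Zero) \<in> lpa_rel E"
    and terms: "a \<in> lpa_terms E" "b \<in> lpa_terms E" "x \<in> lpa_terms E" "y \<in> lpa_terms E"
  shows "(Mult a b, Zero) \<in> lpa_rel E"
proof -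
  note intros = lpa_rel.mult_cong lpa_rel.refl terms lpa_terms.intros
  have "(Mult a b, Mult (Mult a x) (Mult y b)) \<in> lpa_rel E"
    by (intro lpa_rel.sym[OF ax] lpa_rel.sym[OF yb] intros)
  also have "(Mult (Mult a x) (Mult y b), Mult a (Mult x (Mult y b))) \<in> lpa_rel E"
    by (intro lpa_rel.mult_assoc intros)
  also have "(Mult a (Mult x (Mult y b)), Mult a (Mult (Mult x y) b)) \<in> lpa_rel E"
    by (intro lpa_rel.sym[OF lpa_rel.mult_assoc] intros)
  also have "(Mult a (Mult (Mult x y) b), Mult a (Mult Zero b)) \<in> lpa_rel E"
    by (intro xy intros)
  also have "(Mult a (Mult Zero b), Mult a Zero) \<in> lpa_rel E"
    by (intro mult_zero_left intros)
  also have "(Mult a Zero, Zero) \<in> lpa_rel E"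
    by (intro mult_zero_right intros)
  finally show ?thesis .
qed

section \<open>Commutativity when every edge is an isolated loop\<close>

text \<open>The centralizer of \<open>g\<close> is a subalgebra, so it is everything once it
  contains the generators.\<close>

lemma commute_terms:
  assumes g: "g \<in> lpa_terms E" and t: "t \<in> lpa_terms E"
    and vert: "\<And>v. v \<in> verts E \<Longrightarrow> (Mult g (Vertex v), Mult (Vertex v) g) \<in> lpa_rel E"
    and edge: "\<And>e. e \<in> arcs E \<Longrightarrow> (Mult g (Edge e), Mult (Edge e) g) \<in> lpa_rel E"
    and ghost: "\<And>e. e \<in> arcs E \<Longrightarrow> (Mult g (Ghost e), Mult (Ghost e) g) \<in> lpa_rel E"
  shows "(Mult g t, Mult t g) \<in> lpa_rel E"
  using t
proof induction
  case Zero
  show ?case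
    using mult_zero_left[OF g] mult_zero_right[OF g] by (blast intro: lpa_rel.trans lpa_rel.sym)
next
  case (Add a b)
  have "(Mult g (Add a b), Add (Mult g a) (Mult g b)) \<in> lpa_rel E"
    using Add g by (intro lpa_rel.mult_add_right)
  also have "(Add (Mult g a) (Mult g b), Add (Mult a g) (Mult b g)) \<in> lpa_rel E"
    using Add by (intro lpa_rel.add_cong)
  also have "(Add (Mult a g) (Mult b g), Mult (Add a b) g) \<in> lpa_rel E"
    using Add g by (intro lpa_rel.sym[OF lpa_rel.mult_add_left])
  finally show ?case .
next
  case (Scale a r)
  have "(Mult g (Scale r a), Scale r (Mult g a)) \<in> lpa_rel E"
    using Scale g by (intro lpa_rel.mult_scale_right)
  also have "(Scale r (Mult g a), Scale r (Mult a g)) \<in> lpa_rel E"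
    using Scale by (intro lpa_rel.scale_cong)
  also have "(Scale r (Mult a g), Mult (Scale r a) g) \<in> lpa_rel E"
    using Scale g by (intro lpa_rel.sym[OF lpa_rel.mult_scale_left])
  finally show ?case .
next
  case (Mult a b)
  have "(Mult g (Mult a b), Mult (Mult g a) b) \<in> lpa_rel E"
    using Mult g by (intro lpa_rel.sym[OF lpa_rel.mult_assoc])
  also have "(Mult (Mult g a) b, Mult (Mult a g) b) \<in> lpa_rel E"
    using Mult by (intro lpa_rel.mult_cong[OF Mult.IH(1)] lpa_rel.refl)
  also have "(Mult (Mult a g) b, Mult a (Mult g b)) \<in> lpa_rel E"
    using Mult g by (intro lpa_rel.mult_assoc)
  also have "(Mult a (Mult g b), Mult a (Mult b g)) \<in> lpa_rel E"
    using Mult by (intro lpa_rel.mult_cong[OF _ Mult.IH(2)] lpa_rel.refl)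
  also have "(Mult a (Mult b g), Mult (Mult a b) g) \<in> lpa_rel E"
    using Mult g by (intro lpa_rel.sym[OF lpa_rel.mult_assoc])
  finally show ?case .
qed (use assms in auto)

lemma commutative_lpa:
  fixes E :: "('v, 'e) pre_digraph" and a b :: "('r::comm_ring_1, 'v, 'e) lpa_term"
  assumes "wf_digraph E" and loop: "\<And>e. e \<in> arcs E \<Longrightarrow> head E e = tail E e"
    and inj: "inj_on (tail E) (arcs E)"
    and ab: "a \<in> lpa_terms E" "b \<in> lpa_terms E"
  shows "(Mult a b, Mult b a) \<in> lpa_rel E"
proof -
  interpret wf_digraph E by fact
  let ?R = "lpa_rel E :: (('r, 'v, 'e) lpa_term \<times> ('r, 'v, 'e) lpa_term) set"
  \<comment> \<open>Every generator lies in the corner \<open>v L v\<close> of a vertex \<open>v\<close>, and distinct corners annihilate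
    each other.\<close>
  define corner :: "'v \<Rightarrow> ('r, 'v, 'e) lpa_term \<Rightarrow> bool"
    where "corner v g \<longleftrightarrow> v \<in> verts E \<and> g \<in> lpa_terms E \<and>
      (Mult (Vertex v) g, g) \<in> ?R \<and> (Mult g (Vertex v), g) \<in> ?R" for v g
  have corner_V: "corner v (Vertex v)" if "v \<in> verts E" for v
    using that by (auto simp: corner_def intro: lpa_rel.vertex_idem lpa_terms.Vertex)
  have corner_E: "corner (tail E e) (Edge e)" if "e \<in> arcs E" for e
    using that lpa_rel.source_edge[OF that] lpa_rel.edge_range[OF that] loop[OF that]
    by (auto simp: corner_def intro: lpa_terms.intros)
  have corner_G: "corner (tail E e) (Ghost e)" if "e \<in> arcs E" for e
    using that lpa_rel.range_ghost[OF that] lpa_rel.ghost_source[OF that] loop[OF that]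
    by (auto simp: corner_def intro: lpa_terms.intros)
  have diff: "(Mult g h, Mult h g) \<in> ?R" if "corner v g" "corner w h" "v \<noteq> w" for v w g h
  proof -
    have "(Mult g h, Zero) \<in> ?R"
      by (rule mult_eq_zero[of g "Vertex v" E "Vertex w" h])
        (use that in \<open>auto simp: corner_def intro: lpa_rel.vertex_orth lpa_terms.Vertex\<close>)
    moreover have "(Mult h g, Zero) \<in> ?R"
      by (rule mult_eq_zero[of h "Vertex w" E "Vertex v" g])
        (use that in \<open>auto simp: corner_def intro: lpa_rel.vertex_orth lpa_terms.Vertex\<close>)
    ultimately show ?thesis by (blast intro: lpa_rel.trans lpa_rel.sym)
  qed
  have vert: "(Mult (Vertex v) g, Mult g (Vertex v)) \<in> ?R"
    if "v \<in> verts E" "corner w g" for v w g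
  proof (cases "v = w")
    case True
    with that have "(Mult (Vertex v) g, g) \<in> ?R" "(Mult g (Vertex v), g) \<in> ?R"
      by (auto simp: corner_def)
    then show ?thesis by (blast intro: lpa_rel.trans lpa_rel.sym)
  next
    case False
    with that show ?thesis using diff[OF corner_V] by blast
  qed
  \<comment> \<open>Different sources mean different corners; equal sources force
    \<open>e = f\<close> by injectivity. Only generators belonging to a single edge remain to be
    compared.\<close>
  have same: "(Mult g h, Mult h g) \<in> ?R"
    if "corner (tail E e) g" "corner (tail E f) h" "e \<in> arcs E" "f \<in> arcs E"
      "e = f \<Longrightarrow> (Mult g h, Mult h g) \<in> ?R" for e f g h
    using that diff inj by (metis inj_onD)
  \<comment> \<open>The source of \<open>e\<close> emits \<open>e\<close> alone, so it is regular
    and its relation reads \<open>v = ee\<^sup>*\<close>; as \<open>e\<close> is a loop, also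
    \<open>e\<^sup>*e = v\<close>.\<close>
  have edge_ghost: "(Mult (Edge e) (Ghost e), Mult (Ghost e) (Edge e)) \<in> ?R"
    if e: "e \<in> arcs E" for e
  proof -
    have out: "out_arcs E (tail E e) = {e}" using inj e by (auto simp: inj_on_def)
    have EG: "Mult (Edge e) (Ghost e) \<in> lpa_terms E" using e by (intro lpa_terms.intros)
    have "(Mult (Ghost e) (Edge e), Vertex (tail E e)) \<in> ?R"
      using lpa_rel.ghost_edge[OF e] loop[OF e] by simp
    also have "(Vertex (tail E e), foldr (\<lambda>e. Add (Mult (Edge e) (Ghost e))) [e] Zero) \<in> ?R"
      using e out by (intro lpa_rel.regular) (auto simp: regular_vertex_def)
    also have "(foldr (\<lambda>e. Add (Mult (Edge e) (Ghost e))) [e] Zero, Mult (Edge e) (Ghost e)) \<in> ?R"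
      using lpa_rel.add_zero[OF EG] by simp
    finally show ?thesis by (rule lpa_rel.sym)
  qed
  have refl2: "(Mult g g, Mult g g) \<in> ?R" if "corner v g" for v g
    using that by (auto simp: corner_def intro: lpa_rel.refl lpa_terms.Mult)
  \<comment> \<open>The centralizer argument is applied twice: first each generator is shown to be
    central, then these facts put all generators into the centralizer of an arbitrary
    \<open>a\<close>.\<close>
  have gen_E: "(Mult (Edge e) t, Mult t (Edge e)) \<in> ?R"
    if "e \<in> arcs E" "t \<in> lpa_terms E" for e t
  proof (rule commute_terms)
    fix f assume f: "f \<in> arcs E"
    show "(Mult (Edge e) (Edge f), Mult (Edge f) (Edge e)) \<in> ?R"
      by (rule same[OF corner_E corner_E]) (use that f refl2[OF corner_E] in auto)
    show "(Mult (Edge e) (Ghost f), Mult (Ghost f) (Edge e)) \<in> ?R"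
      by (rule same[OF corner_E corner_G]) (use that f edge_ghost in auto)
  next
    fix v assume "v \<in> verts E"
    then show "(Mult (Edge e) (Vertex v), Mult (Vertex v) (Edge e)) \<in> ?R"
      using that by (intro lpa_rel.sym[OF vert[OF _ corner_E]])
  qed (use that in \<open>auto intro: lpa_terms.intros\<close>)
  have gen_G: "(Mult (Ghost e) t, Mult t (Ghost e)) \<in> ?R"
    if "e \<in> arcs E" "t \<in> lpa_terms E" for e t
  proof (rule commute_terms)
    fix f assume f: "f \<in> arcs E"
    show "(Mult (Ghost e) (Ghost f), Mult (Ghost f) (Ghost e)) \<in> ?R"
      by (rule same[OF corner_G corner_G]) (use that f refl2[OF corner_G] in auto)
    show "(Mult (Ghost e) (Edge f), Mult (Edge f) (Ghost e)) \<in> ?R"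
      using that f by (intro lpa_rel.sym[OF gen_E] lpa_terms.Ghost)
  next
    fix v assume "v \<in> verts E"
    then show "(Mult (Ghost e) (Vertex v), Mult (Vertex v) (Ghost e)) \<in> ?R"
      using that by (intro lpa_rel.sym[OF vert[OF _ corner_G]])
  qed (use that in \<open>auto intro: lpa_terms.intros\<close>)
  have gen_V: "(Mult (Vertex v) t, Mult t (Vertex v)) \<in> ?R"
    if "v \<in> verts E" "t \<in> lpa_terms E" for v t
    using that by (intro commute_terms[OF _ _ vert[OF _ corner_V] vert[OF _ corner_E]
          vert[OF _ corner_G]] lpa_terms.Vertex)
  show ?thesis
    by (rule commute_terms;
      intro lpa_rel.sym[OF gen_V] lpa_rel.sym[OF gen_E] lpa_rel.sym[OF gen_G] ab)
qed


section \<open>Vertices are nonzero\<close>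

text \<open>The factor \<open>nat\<close> makes this set infinite as soon as \<open>v\<close> emits
  an edge; if it is also countable, its enumeration is a bijection with \<open>nat\<close>.\<close>

definition branches :: "('v, 'e) pre_digraph \<Rightarrow> 'v \<Rightarrow> ('e \<times> nat) set" where
  "branches E v = out_arcs E v \<times> UNIV"

lemma countable_branches:
  assumes "countable (arcs E)"
  shows "countable (branches E v)"
  unfolding branches_def
  by (intro countable_SIGMA countable_subset[OF _ assms] countableI_type) auto

text \<open>
  The pairs \<open>(v, n)\<close> play the role of the boundary paths starting at \<open>v\<close>. If \<open>v\<close> emits
  an edge, then the enumeration of \<open>branches E v\<close>
  identifies this fibre over \<open>v\<close> with the disjoint union of the fibres over the ranges
  of the edges emitted by \<open>v\<close>.
\<close>

primrec lpa_act ::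
    "('v, 'e) pre_digraph \<Rightarrow> ('r::comm_ring_1, 'v, 'e) lpa_term \<Rightarrow>
      ('v \<times> nat \<Rightarrow> 'r) \<Rightarrow> 'v \<times> nat \<Rightarrow> 'r" where
  "lpa_act E Zero \<phi> = (\<lambda>x. 0)"
| "lpa_act E (Vertex w) \<phi> = (\<lambda>x. if fst x = w then \<phi> x else 0)"
| "lpa_act E (Edge e) \<phi> = (\<lambda>x. let y = from_nat_into (branches E (fst x)) (snd x) in
     if fst x = tail E e \<and> fst y = e then \<phi> (head E e, snd y) else 0)"
| "lpa_act E (Ghost e) \<phi> = (\<lambda>x. if fst x = head E e
     then \<phi> (tail E e, to_nat_on (branches E (tail E e)) (e, snd x)) else 0)"
| "lpa_act E (Add a b) \<phi> = (\<lambda>x. lpa_act E a \<phi> x + lpa_act E b \<phi> x)"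
| "lpa_act E (Scale r a) \<phi> = (\<lambda>x. r * lpa_act E a \<phi> x)"
| "lpa_act E (Mult a b) \<phi> = lpa_act E a (lpa_act E b \<phi>)"

text \<open>Terms act by linear operators. Additivity and homogeneity in \<phi> are what the laws
  \<open>mult_add_right\<close> and \<open>mult_scale_right\<close> require of composition.\<close>

lemma lpa_act_add: "lpa_act E t (\<lambda>x. \<phi> x + \<psi> x) = (\<lambda>x. lpa_act E t \<phi> x + lpa_act E t \<psi> x)"
  by (induction t arbitrary: \<phi> \<psi>) (auto simp: Let_def distrib_left mult.left_commute add_ac)

lemma lpa_act_scale: "lpa_act E t (\<lambda>x. r * \<phi> x) = (\<lambda>x. r * lpa_act E t \<phi> x)"
  by (induction t arbitrary: \<phi>) (auto simp: Let_def distrib_left mult.left_commute add_ac)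

text \<open>The operator of \<open>ee\<^sup>*\<close> is the projection to the part of the fibre
  over the source whose codes decode to a branch starting with \<open>e\<close>.\<close>

lemma lpa_act_edge_ghost:
  assumes "countable (arcs E)" and "e \<in> arcs E"
  shows "lpa_act E (Mult (Edge e) (Ghost e)) \<phi> x =
    (if fst x = tail E e \<and> fst (from_nat_into (branches E (fst x)) (snd x)) = e then \<phi> x else 0)"
proof -
  \<comment> \<open>Because the set of branches is infinite, every natural number is the code of a
    branch, so decoding and encoding returns it unchanged.\<close>
  have "to_nat_on (branches E (tail E e)) (from_nat_into (branches E (tail E e)) n) = n" for n
  proof (rule to_nat_on_from_nat_into_infinite)
    show "countable (branches E (tail E e))" using assms(1) by (rule countable_branches)
    show "infinite (branches E (tail E e))"
      using assms(2) by (auto simp: branches_def finite_cartesian_product_iff)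
  qed
  from this[of "snd x"] show ?thesis
    by (cases x; cases "from_nat_into (branches E (fst x)) (snd x)") (auto simp: Let_def)
qed

text \<open>Projections belonging to distinct edges have disjoint supports, so their sum is the
  projection to the union. Allowing only some of the emitted edges lets the induction on
  \<open>es\<close> run.\<close>

lemma lpa_act_regular:
  assumes "countable (arcs E)" and "distinct es" and "set es \<subseteq> out_arcs E v"
  shows "lpa_act E (foldr (\<lambda>e. Add (Mult (Edge e) (Ghost e))) es Zero) \<phi> x =
    (if fst x = v \<and> fst (from_nat_into (branches E v) (snd x)) \<in> set es then \<phi> x else 0)"
  using assms(2,3)
proof (induction es)
  case (Cons e es)
  have "lpa_act E (foldr (\<lambda>e. Add (Mult (Edge e) (Ghost e))) (e # es) Zero) \<phi> x =
    lpa_act E (Mult (Edge e) (Ghost e)) \<phi> x +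
    lpa_act E (foldr (\<lambda>e. Add (Mult (Edge e) (Ghost e))) es Zero) \<phi> x"
    by simp
  also have "\<dots> = (if fst x = v \<and> fst (from_nat_into (branches E v) (snd x)) \<in> set (e # es)
      then \<phi> x else 0)"
    using Cons by (subst lpa_act_edge_ghost[OF assms(1)]) auto
  finally show ?case .
qed simp

text \<open>The operators satisfy all laws and defining relations, so the action descends to the
  Leavitt path algebra.\<close>

lemma lpa_act_cong:
  assumes "countable (arcs E)" and "(a, b) \<in> lpa_rel E"
  shows "lpa_act E a = lpa_act E b"
  using assms(2)
proof induction
  case (ghost_edge e)
  have "countable (branches E (tail E e))" using assms(1) by (rule countable_branches)
  with ghost_edge show ?case by (auto simp: fun_eq_iff branches_def)
next
  case (ghost_edge_orth e f)
  have "countable (branches E (tail E e))" using assms(1) by (rule countable_branches)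
  with ghost_edge_orth show ?case by (auto simp: fun_eq_iff branches_def)
next
  case (regular v es)
  \<comment> \<open>A regular vertex has a nonempty set of branches, so decoding always yields an
    emitted edge and the sum of projections covers the whole fibre.\<close>
  have "fst (from_nat_into (branches E v) n) \<in> set es" for n
    using from_nat_into[of "branches E v" n] regular by (auto simp: branches_def regular_vertex_def)
  with regular show ?case
    by (intro ext) (simp add: lpa_act_regular[OF assms(1), of es v])
qed (auto simp: lpa_act_add lpa_act_scale algebra_simps Let_def intro!: ext)

lemma vertex_nonzero:
  assumes "countable (arcs E)"
  shows "(Vertex v :: ('r::comm_ring_1, 'v, 'e) lpa_term, Zero) \<notin> lpa_rel E"
proof
  assume "(Vertex v :: ('r, 'v, 'e) lpa_term, Zero) \<in> lpa_rel E"
  \<comment> \<open>Evaluating both operators on the constant function 1 at \<open>(v, 0)\<close>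
    gives 1 = 0 in the coefficient ring.\<close>
  from lpa_act_cong[OF assms this] have "lpa_act E (Vertex v :: ('r, 'v, 'e) lpa_term) (\<lambda>_. 1) (v, 0) =
      lpa_act E (Zero :: ('r, 'v, 'e) lpa_term) (\<lambda>_. 1) (v, 0)"
    by simp
  then show False by simp
qed

text \<open>If \<open>e\<close> vanished, so would \<open>e\<^sup>*e\<close>, which is a
  vertex.\<close>

lemma edge_nonzero:
  assumes "countable (arcs E)" and e: "e \<in> arcs E"
  shows "(Edge e :: ('r::comm_ring_1, 'v, 'e) lpa_term, Zero) \<notin> lpa_rel E"
proof
  let ?G = "Ghost e :: ('r, 'v, 'e) lpa_term"
  assume *: "(Edge e :: ('r, 'v, 'e) lpa_term, Zero) \<in> lpa_rel E"
  have G: "?G \<in> lpa_terms E" using e by (rule lpa_terms.Ghost)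
  have "(Vertex (head E e), Mult ?G (Edge e)) \<in> lpa_rel E"
    using e by (rule lpa_rel.sym[OF lpa_rel.ghost_edge])
  also have "(Mult ?G (Edge e), Mult ?G Zero) \<in> lpa_rel E"
    using * G by (intro lpa_rel.mult_cong lpa_rel.refl)
  also have "(Mult ?G Zero, Zero) \<in> lpa_rel E" using G by (rule mult_zero_right)
  finally show False using vertex_nonzero[OF assms(1)] by blast
qed

section \<open>Dextral symmetry and the shape of the graph\<close>

theorem lemma3p6:
  fixes E :: "('v, 'e) pre_digraph"
  assumes "wf_digraph E"
    and "countable (verts E)"
    and "countable (arcs E)"
  shows "dextral_symmetric (leavitt_path_algebra E :: ('r::comm_ring_1, 'v, 'e) lpa) \<longleftrightarrow>
    (\<forall>C. pre_digraph.max_subgraph E Digraph_Component.connected C \<longrightarrow>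
      (\<exists>v. verts C = {v} \<and> arcs C = {}) \<or>
      (\<exists>v e. verts C = {v} \<and> arcs C = {e} \<and> tail C e = v \<and> head C e = v))"
  unfolding components_iff[OF assms(1)] dextral_symmetric_lpa_iff[OF assms(1)]
proof (intro iffI ballI impI conjI)
  interpret wf_digraph E by fact
  assume dextral: "\<forall>a \<in> lpa_terms E. \<forall>b \<in> lpa_terms E. \<forall>c \<in> lpa_terms E.
      (Mult a (Mult b c) :: ('r, 'v, 'e) lpa_term, Zero) \<in> lpa_rel E \<longrightarrow>
      (Mult b (Mult a c), Zero) \<in> lpa_rel E"
  note intros = lpa_rel.mult_cong lpa_rel.refl lpa_terms.intros
  \<comment> \<open>The form in which dextral symmetry is used: \<open>bc = 0\<close> gives
    \<open>a(bc) = 0\<close>, so any \<open>a\<close> may be inserted between the factors of a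
    vanishing product.\<close>
  have zero: "(Mult b (Mult a c), Zero) \<in> lpa_rel E"
    if "a \<in> lpa_terms E" "b \<in> lpa_terms E" "c \<in> lpa_terms E"
      "(Mult b c, Zero) \<in> lpa_rel E" for a b c :: "('r, 'v, 'e) lpa_term"
  proof -
    have "(Mult a (Mult b c), Mult a Zero) \<in> lpa_rel E" using that by (intro intros)
    also have "(Mult a Zero, Zero) \<in> lpa_rel E" using that by (intro mult_zero_right)
    finally show ?thesis using dextral that by blast
  qed
  show loop: "head E e = tail E e" if e: "e \<in> arcs E" for e
  proof (rule ccontr)
    let ?e = "Edge e :: ('r, 'v, 'e) lpa_term"
    assume ne: "head E e \<noteq> tail E e"
    have "(?e, Mult (Vertex (tail E e)) ?e) \<in> lpa_rel E"
      using e by (rule lpa_rel.sym[OF lpa_rel.source_edge])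
    also have "(Mult (Vertex (tail E e)) ?e,
        Mult (Vertex (tail E e)) (Mult ?e (Vertex (head E e)))) \<in> lpa_rel E"
      using e by (intro lpa_rel.sym[OF lpa_rel.edge_range] intros) auto
    also have "(Mult (Vertex (tail E e)) (Mult ?e (Vertex (head E e))), Zero) \<in> lpa_rel E"
      using e ne by (intro zero lpa_rel.vertex_orth lpa_terms.intros) auto
    finally show False using edge_nonzero[OF assms(3) e] by blast
  qed
  show "inj_on (tail E) (arcs E)"
  proof (rule inj_onI, rule ccontr)
    fix e f
    assume e: "e \<in> arcs E" and f: "f \<in> arcs E" and tails: "tail E e = tail E f" and ne: "e \<noteq> f"
    let ?e = "Edge e :: ('r, 'v, 'e) lpa_term" and ?f = "Edge f :: ('r, 'v, 'e) lpa_term"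
    \<comment> \<open>Since \<open>e\<close> is already known to be a loop, the source of
      \<open>f\<close> is also the range of \<open>e\<close> and can be replaced by
      \<open>e\<^sup>*e\<close>. This exhibits \<open>f\<close> as \<open>e\<close> inserted into
      the vanishing product \<open>e\<^sup>*f\<close>.\<close>
    have "(?f, Mult (Vertex (head E e)) ?f) \<in> lpa_rel E"
      using lpa_rel.sym[OF lpa_rel.source_edge[OF f]] loop[OF e] tails by simp
    also have "(Mult (Vertex (head E e)) ?f, Mult (Mult (Ghost e) ?e) ?f) \<in> lpa_rel E"
      using e f by (intro lpa_rel.sym[OF lpa_rel.ghost_edge] intros)
    also have "(Mult (Mult (Ghost e) ?e) ?f, Mult (Ghost e) (Mult ?e ?f)) \<in> lpa_rel E"
      using e f by (intro lpa_rel.mult_assoc intros)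
    also have "(Mult (Ghost e) (Mult ?e ?f), Zero) \<in> lpa_rel E"
      using e f ne by (intro zero lpa_rel.ghost_edge_orth lpa_terms.intros)
    finally show False using edge_nonzero[OF assms(3) f] by blast
  qed
next
  fix a b c :: "('r, 'v, 'e) lpa_term"
  assume E: "(\<forall>e \<in> arcs E. head E e = tail E e) \<and> inj_on (tail E) (arcs E)"
    and terms: "a \<in> lpa_terms E" "b \<in> lpa_terms E" "c \<in> lpa_terms E"
    and abc: "(Mult a (Mult b c), Zero) \<in> lpa_rel E"
  \<comment> \<open>Commutativity and associativity identify \<open>b(ac)\<close> with
    \<open>a(bc)\<close>.\<close>
  have "(Mult b (Mult a c), Mult (Mult b a) c) \<in> lpa_rel E"
    using terms by (intro lpa_rel.sym[OF lpa_rel.mult_assoc])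
  also have "(Mult (Mult b a) c, Mult (Mult a b) c) \<in> lpa_rel E"
    using terms E by (intro lpa_rel.mult_cong lpa_rel.refl commutative_lpa[OF assms(1)]) auto
  also have "(Mult (Mult a b) c, Mult a (Mult b c)) \<in> lpa_rel E"
    using terms by (intro lpa_rel.mult_assoc)
  also note abc
  finally show "(Mult b (Mult a c), Zero) \<in> lpa_rel E" .
qed

end
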